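(* Let $Z$ be a target random variable and $\mathcal{X}=\{X_1,\ldots,X_n\}$ a set of predictor random variables, all with mean $0$ and variance $1$, and let $C_{\mathcal{X}}$ be the (positive definite) covariance matrix of $\mathcal{X}$. Let $\mathcal{B}\subseteq\mathcal{X}$. Then for every $\mathcal{A}\subseteq\mathcal{B}$, $$\sum_{X_i\in\mathcal{B}\setminus\mathcal{A}}\left(R^2_{Z,\mathcal{B}}-R^2_{Z,\mathcal{B}\setminus\{X_i\}}\right)\;\le\;\beta\left(R^2_{Z,\mathcal{B}}-R^2_{Z,\mathcal{A}}\right)$$ holds for some $\beta$ with $\beta\le \frac{1}{\lambda_{\min}(C_{\mathcal{X}},|\mathcal{B}|)}\le\frac{1}{\lambda_{\min}(C_{\mathcal{X}})}$.
   Context: For $\mathcal{S}\subseteq\mathcal{X}$, $C_{\mathcal{S}}$ is the principal submatrix of $C_{\mathcal{X}}$ indexed by $\mathcal{S}$, $\vec b_{Z,\mathcal{S}}$ is the vector with entries $\mathrm{cov}(X_i,Z)$ for $X_i\in\mathcal{S}$, and the squared multiple correlation ($R^2$ objective) is $R^2_{Z,\mathcal{S}}=1-\mathbb{E}[(Z-Z_{\mathcal{S}})^2]=\vec b_{Z,\mathcal{S}}^T C_{\mathcal{S}}^{-1}\vec b_{Z,\mathcal{S}}$, where $Z_{\mathcal{S}}$ is the best linear predictor of $Z$ from $\mathcal{S}$ (with $R^2_{Z,\emptyset}=0$). $\lambda_{\min}(C)$ is the smallest eigenvalue of $C$, and $\lambda_{\min}(C,m)=\min\{\vec v^TC\vec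 v:\|\vec v\|_2=1,\ \vec v\text{ has at most }m\text{ nonzero entries}\}$ is the smallest $m$-sparse eigenvalue. *)

theory Defs
  imports "HOL-Probability.Probability"
begin

definition cov :: "'a measure \<Rightarrow> ('a \<Rightarrow> real) \<Rightarrow> ('a \<Rightarrow> real) \<Rightarrow> real" where
  "cov M U V = (\<integral>\<omega>. (U \<omega> - (\<integral>\<omega>. U \<omega> \<partial>M)) * (V \<omega> - (\<integral>\<omega>. V \<omega> \<partial>M)) \<partial>M)"

definition cov_matrix :: "'a measure \<Rightarrow> ('n \<Rightarrow> 'a \<Rightarrow> real) \<Rightarrow> real ^ 'n ^ 'n" where
  "cov_matrix M X = (\<chi> i j. cov M (X i) (X j))"

definition positive_definite :: "real ^ 'n ^ 'n \<Rightarrow> bool" where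
  "positive_definite A \<longleftrightarrow> transpose A = A \<and> (\<forall>v. v \<noteq> 0 \<longrightarrow> 0 < v \<bullet> (A *v v))"

definition eigenvalue :: "real ^ 'n ^ 'n \<Rightarrow> real \<Rightarrow> bool" where
  "eigenvalue A k \<longleftrightarrow> (\<exists>v. v \<noteq> 0 \<and> A *v v = k *\<^sub>R v)"

definition lambda_min :: "real ^ 'n ^ 'n \<Rightarrow> real" where
  "lambda_min A = (LEAST k. eigenvalue A k)"

(* LEAST is the minimum whenever it is attained; for a symmetric matrix it is, by compactness,
   provided 0 < m. For m = 0 there is no admissible v and the value is unspecified. *)
definition sparse_lambda_min :: "real ^ 'n ^ 'n \<Rightarrow> nat \<Rightarrow> real" where
  "sparse_lambda_min A m =
     (LEAST k. \<exists>v. norm v = 1 \<and> card {i. v $ i \<noteq> 0} \<le> m \<and> k = v \<bullet> (A *v v))"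

definition linear_predictor :: "('n \<Rightarrow> 'a \<Rightarrow> real) \<Rightarrow> 'n set \<Rightarrow> ('n \<Rightarrow> real) \<Rightarrow> 'a \<Rightarrow> real" where
  "linear_predictor X S a \<omega> = (\<Sum>i\<in>S. a i * X i \<omega>)"

(* There is no intercept term: the predictors and the target are centred. *)
definition best_linear_predictor ::
  "'a measure \<Rightarrow> ('a \<Rightarrow> real) \<Rightarrow> ('n \<Rightarrow> 'a \<Rightarrow> real) \<Rightarrow> 'n set \<Rightarrow> 'a \<Rightarrow> real" where
  "best_linear_predictor M Z X S =
     linear_predictor X S
       (ARG_MIN (\<lambda>a. \<integral>\<omega>. (Z \<omega> - linear_predictor X S a \<omega>)\<^sup>2 \<partial>M) a. True)"

definition R2 :: "'a measure \<Rightarrow> ('a \<Rightarrow> real) \<Rightarrow> ('n \<Rightarrow> 'a \<Rightarrow> real) \<Rightarrow> 'n set \<Rightarrow> real" where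
  "R2 M Z X S = 1 - (\<integral>\<omega>. (Z \<omega> - best_linear_predictor M Z X S \<omega>)\<^sup>2 \<partial>M)"

end

theory Submission
  imports Defs
begin

text \<open>
  Let \<open>a\<close> be the coefficient vector of the best linear predictor on \<open>B\<close>. By the normal equations,
  \<open>R\<^sup>2(B) - R\<^sup>2(S)\<close> for \<open>S \<subseteq> B\<close> is the minimum of \<open>(w - a)\<^sup>T C (w - a)\<close> over the vectors \<open>w\<close> supported
  on \<open>S\<close>. Zeroing the coordinate \<open>i\<close> of \<open>a\<close> shows that removing \<open>i\<close> loses at most
  \<open>a\<^sub>i\<^sup>2 C\<^sub>i\<^sub>i = a\<^sub>i\<^sup>2\<close>. If \<open>w\<close> is the minimizer for \<open>A\<close>, then \<open>w - a\<close> is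
  supported on \<open>B\<close> and agrees with \<open>-a\<close> on \<open>B - A\<close>, so the loss of passing to \<open>A\<close> is at least
  the sparse eigenvalue times \<open>\<Sum>i\<in>B - A. a\<^sub>i\<^sup>2\<close>.
\<close>

section \<open>Quadratic forms\<close>

lemma symmetric_matrix_inner_commute:
  fixes A :: "real ^ 'n ^ 'n"
  assumes "transpose A = A"
  shows "v \<bullet> (A *v w) = w \<bullet> (A *v v)"
  by (metis assms dot_lmul_matrix inner_commute transpose_matrix_vector)

lemma quadratic_form_add:
  fixes A :: "real ^ 'n ^ 'n"
  assumes "transpose A = A"
  shows "(v + w) \<bullet> (A *v (v + w)) = v \<bullet> (A *v v) + 2 * (w \<bullet> (A *v v)) + w \<bullet> (A *v w)"
  using symmetric_matrix_inner_commute[OF assms, of v w]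
  by (simp add: matrix_vector_right_distrib inner_add_left inner_add_right)

lemma quadratic_form_scaleR:
  fixes A :: "real ^ 'n ^ 'n"
  shows "(c *\<^sub>R v) \<bullet> (A *v (c *\<^sub>R v)) = c\<^sup>2 * (v \<bullet> (A *v v))"
  by (simp add: matrix_vector_mult_scaleR power2_eq_square)

lemma quadratic_form_ge_if_unit_ge:
  fixes A :: "real ^ 'n ^ 'n"
  assumes "v \<noteq> 0 \<Longrightarrow> k \<le> sgn v \<bullet> (A *v sgn v)"
  shows "k * (v \<bullet> v) \<le> v \<bullet> (A *v v)"
proof (cases "v = 0")
  case False
  have v: "v = norm v *\<^sub>R sgn v"
    using False by (simp add: sgn_div_norm)
  have "v \<bullet> (A *v v) = (norm v)\<^sup>2 * (sgn v \<bullet> (A *v sgn v))"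
    using quadratic_form_scaleR[of "norm v" "sgn v" A] v by simp
  then show ?thesis
    using assms[OF False] by (simp add: power2_norm_eq_inner mult.commute[of k] mult_left_mono)
qed simp

section \<open>Sparse and smallest eigenvalues\<close>

lemma continuous_on_quadratic_form:
  fixes A :: "real ^ 'n ^ 'n"
  shows "continuous_on S (\<lambda>v. v \<bullet> (A *v v))"
  by (intro continuous_intros linear_continuous_on linear_conv_bounded_linear[THEN iffD1]
      matrix_vector_mul_linear)

text \<open>A finite union of coordinate subspaces, one for each possible support of size at most
  \<open>m\<close>.\<close>

lemma closed_sparse_vectors: "closed {v :: real ^ 'n. card {i. v $ i \<noteq> 0} \<le> m}"
proof -
  have "{v :: real ^ 'n. card {i. v $ i \<noteq> 0} \<le> m}
      = (\<Union>S\<in>{S. card S \<le> m}. {v. \<forall>i. i \<notin> S \<longrightarrow> v $ i = 0})" (is "?L = ?R")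
  proof
    show "?L \<subseteq> ?R" by auto
    show "?R \<subseteq> ?L"
    proof clarify
      fix v :: "real ^ 'n" and S :: "'n set"
      assume "card S \<le> m" "\<forall>i. i \<notin> S \<longrightarrow> v $ i = 0"
      moreover have "card {i. v $ i \<noteq> 0} \<le> card S"
        by (rule card_mono) (use calculation in auto)
      ultimately show "card {i. v $ i \<noteq> 0} \<le> m" by linarith
    qed
  qed
  moreover have "closed {v :: real ^ 'n. \<forall>i. i \<notin> S \<longrightarrow> v $ i = 0}" for S
    by (intro closed_Collect_all closed_Collect_imp closed_Collect_eq open_Collect_const
        continuous_intros)
  ultimately show ?thesis by (simp add: closed_UN)
qed

text \<open>\<open>LEAST\<close> over the reals yields a minimum only where one is attained. Here
  the \<open>m\<close>-sparse unit vectors form a compact set, nonempty because \<open>0 < m\<close>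
  admits the coordinate vectors.\<close>

lemma sparse_lambda_min_attained:
  fixes A :: "real ^ 'n ^ 'n"
  assumes "0 < m"
  obtains v where "norm v = 1" "card {i. v $ i \<noteq> 0} \<le> m" "sparse_lambda_min A m = v \<bullet> (A *v v)"
    "\<And>w. norm w = 1 \<Longrightarrow> card {i. w $ i \<noteq> 0} \<le> m \<Longrightarrow> sparse_lambda_min A m \<le> w \<bullet> (A *v w)"
proof -
  let ?K = "sphere 0 1 \<inter> {v :: real ^ 'n. card {i. v $ i \<noteq> 0} \<le> m}"
  obtain j :: 'n where True by simp
  have "{i. axis j (1::real) $ i \<noteq> 0} = {j}"
    by (auto simp: axis_def)
  then have "axis j 1 \<in> ?K"
    using assms by simp
  then have "?K \<noteq> {}" by blast
  moreover have "compact ?K"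
    by (intro compact_Int_closed closed_sparse_vectors) simp
  ultimately have "\<exists>v\<in>?K. \<forall>w\<in>?K. v \<bullet> (A *v v) \<le> w \<bullet> (A *v w)"
    by (intro continuous_attains_inf continuous_on_quadratic_form)
  then obtain v where v: "v \<in> ?K" "\<And>w. w \<in> ?K \<Longrightarrow> v \<bullet> (A *v v) \<le> w \<bullet> (A *v w)"
    by blast
  have "sparse_lambda_min A m = v \<bullet> (A *v v)"
    unfolding sparse_lambda_min_def by (rule Least_equality) (use v in auto)
  then show thesis
    using v by (intro that) auto
qed

lemma sparse_lambda_min_pos:
  assumes "positive_definite A" "0 < m"
  shows "0 < sparse_lambda_min A m"
  by (metis assms norm_zero positive_definite_def sparse_lambda_min_attained zero_neq_one)

lemma sparse_lambda_min_le_quadratic_form: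
  fixes A :: "real ^ 'n ^ 'n"
  assumes "0 < m" "card {i. v $ i \<noteq> 0} \<le> m"
  shows "sparse_lambda_min A m * (v \<bullet> v) \<le> v \<bullet> (A *v v)"
proof (rule quadratic_form_ge_if_unit_ge)
  assume "v \<noteq> 0"
  then have "{i. sgn v $ i \<noteq> 0} = {i. v $ i \<noteq> 0}"
    by (auto simp: sgn_div_norm)
  then show "sparse_lambda_min A m \<le> sgn v \<bullet> (A *v sgn v)"
    using sparse_lambda_min_attained[OF assms(1), of A] assms(2) \<open>v \<noteq> 0\<close>
    by (metis norm_sgn)
qed

text \<open>Move from \<open>v\<close> along \<open>?u = A *v v\<close>: the form becomes
  \<open>2 * t * (?u \<bullet> ?u) + t\<^sup>2 * q\<close>, which a small negative \<open>t\<close>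
  would make negative if \<open>?u\<close> were nonzero.\<close>

lemma psd_form_zero_imp_kernel:
  fixes A :: "real ^ 'n ^ 'n"
  assumes "transpose A = A" "\<And>w. 0 \<le> w \<bullet> (A *v w)" "v \<bullet> (A *v v) = 0"
  shows "A *v v = 0"
proof -
  let ?u = "A *v v"
  define q where "q = ?u \<bullet> (A *v ?u)"
  \<comment> \<open>Minimizing over \<open>t\<close> would give the denominator \<open>q\<close>;
    \<open>q + 1\<close> also covers \<open>q = 0\<close> and still yields a negative value unless
    \<open>?u = 0\<close>.\<close>
  define t where "t = - (?u \<bullet> ?u) / (q + 1)"
  have q: "0 \<le> q" unfolding q_def by (rule assms(2))
  have "0 \<le> 2 * t * (?u \<bullet> ?u) + t\<^sup>2 * q"
    using assms(2)[of "v + t *\<^sub>R ?u"] assms(3)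
    unfolding quadratic_form_add[OF assms(1)] quadratic_form_scaleR q_def by simp
  also have "\<dots> = - ((?u \<bullet> ?u) / (q + 1))\<^sup>2 * (q + 2)"
    using q by (simp add: t_def power2_eq_square divide_simps) (simp add: algebra_simps)
  finally have "((?u \<bullet> ?u) / (q + 1))\<^sup>2 * (q + 2) \<le> 0" by simp
  then have "((?u \<bullet> ?u) / (q + 1))\<^sup>2 \<le> 0"
    using q by (simp add: mult_le_0_iff)
  then show ?thesis using q by simp
qed

text \<open>Rayleigh's principle. If \<open>v\<close> minimizes the form on the unit sphere, the
  shifted matrix \<open>?D\<close> is positive semidefinite and its form vanishes at
  \<open>v\<close>, so \<open>v\<close> is an eigenvector for \<open>?k\<close>. Every eigenvalue is
  a Rayleigh quotient, hence at least \<open>?k\<close>.\<close>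

lemma lambda_min_eq_sparse_lambda_min:
  fixes A :: "real ^ 'n ^ 'n"
  assumes A: "transpose A = A"
  shows "lambda_min A = sparse_lambda_min A CARD('n)"
proof -
  let ?k = "sparse_lambda_min A CARD('n)"
  obtain v where v: "norm v = 1" "?k = v \<bullet> (A *v v)"
    by (rule sparse_lambda_min_attained[of "CARD('n)" A]) auto
  let ?D = "A - ?k *\<^sub>R mat 1"
  have D: "?D *v w = A *v w - ?k *\<^sub>R w" for w
    by (simp add: matrix_vector_mult_diff_rdistrib scaleR_matrix_vector_assoc[symmetric])
  have ge: "?k * (w \<bullet> w) \<le> w \<bullet> (A *v w)" for w
    by (rule sparse_lambda_min_le_quadratic_form) (auto intro: card_mono)
  have "?D *v v = 0"
  proof (rule psd_form_zero_imp_kernel)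
    show "transpose ?D = ?D"
      using A by (simp add: transpose_def vec_eq_iff mat_def)
    show "0 \<le> w \<bullet> (?D *v w)" for w
      using ge[of w] by (simp add: D inner_diff_right)
    show "v \<bullet> (?D *v v) = 0"
      using v unfolding D inner_diff_right by (simp add: norm_eq_1)
  qed
  then have "eigenvalue A ?k"
    using v(1) unfolding eigenvalue_def by (intro exI[of _ v]) (auto simp: D)
  moreover have "?k \<le> k" if "eigenvalue A k" for k
  proof -
    from that obtain w where w: "w \<noteq> 0" "A *v w = k *\<^sub>R w"
      unfolding eigenvalue_def by auto
    then have "?k * (w \<bullet> w) \<le> k * (w \<bullet> w)"
      using ge[of w] by simp
    then show ?thesis using w(1) by simp
  qed
  ultimately show ?thesis
    unfolding lambda_min_def by (rule Least_equality)
qed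

lemma lambda_min_le_sparse_lambda_min:
  fixes A :: "real ^ 'n ^ 'n"
  assumes "transpose A = A" "0 < m"
  shows "lambda_min A \<le> sparse_lambda_min A m"
proof -
  obtain v where v: "norm v = 1" "sparse_lambda_min A m = v \<bullet> (A *v v)"
    by (rule sparse_lambda_min_attained[OF assms(2), of A]) auto
  have "sparse_lambda_min A CARD('n) * (v \<bullet> v) \<le> v \<bullet> (A *v v)"
    by (rule sparse_lambda_min_le_quadratic_form) (auto intro: card_mono)
  then show ?thesis
    using v by (simp add: lambda_min_eq_sparse_lambda_min[OF assms(1)] norm_eq_1)
qed

section \<open>Linear systems restricted to a coordinate set\<close>

lemma positive_definite_restricted_system_solvable:
  fixes A :: "real ^ 'n ^ 'n"
  assumes "positive_definite A"
  obtains v where "\<And>i. i \<notin> S \<Longrightarrow> v $ i = 0" "\<And>i. i \<in> S \<Longrightarrow> (A *v v) $ i = b $ i"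
proof -
  \<comment> \<open>Rows of \<open>A\<close> on \<open>S\<close> and identity rows elsewhere encode
    both requirements in one endomorphism, so injectivity suffices. If \<open>T v = 0\<close>, each
    product \<open>v $ i * (A *v v) $ i\<close> has a zero factor, so the form vanishes at
    \<open>v\<close>.\<close>
  define T where "T v = (\<chi> i. if i \<in> S then (A *v v) $ i else v $ i)" for v
  have lin: "linear T"
    by (rule linearI) (auto simp: T_def vec_eq_iff matrix_vector_right_distrib matrix_vector_mult_scaleR)
  have "v = 0" if "T v = 0" for v
  proof (rule ccontr)
    assume "v \<noteq> 0"
    have "v $ i * (A *v v) $ i = 0" for i
      using that by (auto simp: T_def vec_eq_iff split: if_splits)
    then have "v \<bullet> (A *v v) = 0"
      unfolding inner_vec_def by (intro sum.neutral) simp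
    then show False
      using assms \<open>v \<noteq> 0\<close> by (auto simp: positive_definite_def)
  qed
  then have "inj T"
    using lin by (simp add: linear_injective_0)
  then have "surj T"
    using lin by (simp add: linear_injective_imp_surjective)
  then obtain v where v: "T v = (\<chi> i. if i \<in> S then b $ i else 0)"
    by (metis surjD)
  show thesis
    by (rule that[of v]) (use v in \<open>auto simp: T_def vec_eq_iff split: if_splits\<close>)
qed

section \<open>Regression\<close>

lemma integrable_mult_of_squares:
  fixes f g :: "'a \<Rightarrow> real"
  assumes [measurable]: "f \<in> borel_measurable M" "g \<in> borel_measurable M"
    and "integrable M (\<lambda>\<omega>. (f \<omega>)\<^sup>2)" "integrable M (\<lambda>\<omega>. (g \<omega>)\<^sup>2)"
  shows "integrable M (\<lambda>\<omega>. f \<omega> * g \<omega>)"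
proof (rule Bochner_Integration.integrable_bound)
  show "integrable M (\<lambda>\<omega>. (f \<omega>)\<^sup>2 + (g \<omega>)\<^sup>2)"
    using assms by simp
  have "\<bar>x * y\<bar> \<le> x\<^sup>2 + y\<^sup>2" for x y :: real
  proof -
    have "2 * (\<bar>x\<bar> * \<bar>y\<bar>) \<le> x\<^sup>2 + y\<^sup>2"
      using sum_squares_bound[of "\<bar>x\<bar>" "\<bar>y\<bar>"] by simp
    moreover have "0 \<le> \<bar>x\<bar> * \<bar>y\<bar>" by simp
    ultimately show ?thesis unfolding abs_mult by linarith
  qed
  then show "AE \<omega> in M. norm (f \<omega> * g \<omega>) \<le> norm ((f \<omega>)\<^sup>2 + (g \<omega>)\<^sup>2)"
    by simp
qed simp

section \<open>Mean squared error and the normal equations\<close>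

locale regression = prob_space M for M :: "'a measure" +
  fixes Z :: "'a \<Rightarrow> real" and X :: "'n::finite \<Rightarrow> 'a \<Rightarrow> real"
  assumes Z_measurable [measurable]: "Z \<in> borel_measurable M"
    and X_measurable [measurable]: "\<And>i. X i \<in> borel_measurable M"
    and Z_square_integrable: "integrable M (\<lambda>\<omega>. (Z \<omega>)\<^sup>2)"
    and X_square_integrable: "\<And>i. integrable M (\<lambda>\<omega>. (X i \<omega>)\<^sup>2)"
    and X_centred: "\<And>i. expectation (X i) = 0"
    and cov_positive_definite: "positive_definite (cov_matrix M X)"
begin

abbreviation C :: "real ^ 'n ^ 'n" where
  "C \<equiv> cov_matrix M X"

text \<open>The covariances of the predictors with \<open>Z\<close>, since each \<open>X i\<close>
  is centred.\<close>

definition cross_moments :: "real ^ 'n" where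
  "cross_moments = (\<chi> i. expectation (\<lambda>\<omega>. X i \<omega> * Z \<omega>))"

text \<open>A subset of predictors is encoded by coefficients vanishing outside it, so the full
  matrix \<open>C\<close> serves for all subsets in place of principal submatrices.\<close>

definition mse :: "real ^ 'n \<Rightarrow> real" where
  "mse v = expectation (\<lambda>\<omega>. (Z \<omega> - (\<Sum>i\<in>UNIV. v $ i * X i \<omega>))\<^sup>2)"

lemma C_symmetric: "transpose C = C"
  using cov_positive_definite by (simp add: positive_definite_def)

lemma C_nonneg: "0 \<le> v \<bullet> (C *v v)"
  using cov_positive_definite by (cases "v = 0") (auto simp: positive_definite_def less_imp_le)

lemma mse_eq: "mse v = expectation (\<lambda>\<omega>. (Z \<omega>)\<^sup>2) - 2 * (v \<bullet> cross_moments) + v \<bullet> (C *v v)"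
proof -
  note [simp] = integrable_mult_of_squares[OF X_measurable Z_measurable X_square_integrable Z_square_integrable]
    integrable_mult_of_squares[OF X_measurable X_measurable X_square_integrable X_square_integrable]
    Z_square_integrable
  have "(Z \<omega> - (\<Sum>i\<in>UNIV. v $ i * X i \<omega>))\<^sup>2 = (Z \<omega>)\<^sup>2
      - 2 * (\<Sum>i\<in>UNIV. v $ i * (X i \<omega> * Z \<omega>))
      + (\<Sum>i\<in>UNIV. \<Sum>j\<in>UNIV. v $ i * (v $ j * (X i \<omega> * X j \<omega>)))" for \<omega>
    unfolding power2_diff by (simp add: power2_eq_square sum_product sum_distrib_left ac_simps)
  then have "mse v = expectation (\<lambda>\<omega>. (Z \<omega>)\<^sup>2)
      - 2 * (\<Sum>i\<in>UNIV. v $ i * expectation (\<lambda>\<omega>. X i \<omega> * Z \<omega>))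
      + (\<Sum>i\<in>UNIV. \<Sum>j\<in>UNIV. v $ i * (v $ j * expectation (\<lambda>\<omega>. X i \<omega> * X j \<omega>)))"
    by (simp add: mse_def)
  then show ?thesis
    by (simp add: cross_moments_def inner_vec_def matrix_vector_mult_def cov_matrix_def cov_def
        X_centred sum_distrib_left ac_simps)
qed

text \<open>Expanding around \<open>v\<close> leaves the linear term
  \<open>2 * ((w - v) \<bullet> (C *v v - cross_moments))\<close>. It vanishes coordinatewise: the
  first factor off \<open>S\<close>, the second on \<open>S\<close>.\<close>

lemma mse_diff_normal_equations:
  assumes "\<And>i. i \<notin> S \<Longrightarrow> w $ i = 0" "\<And>i. i \<notin> S \<Longrightarrow> v $ i = 0"
    and normal: "\<And>i. i \<in> S \<Longrightarrow> (C *v v) $ i = cross_moments $ i"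
  shows "mse w - mse v = (w - v) \<bullet> (C *v (w - v))"
proof -
  have "(w - v) \<bullet> (C *v v - cross_moments) = 0"
    unfolding inner_vec_def
    by (rule sum.neutral) (metis (no_types, lifting) assms diff_self inner_zero_left inner_zero_right vector_minus_component)
  then show ?thesis
    using quadratic_form_add[OF C_symmetric, of v "w - v"]
    by (simp add: mse_eq inner_diff_left inner_diff_right)
qed

lemma R2_eq_mse:
  assumes v: "\<And>i. i \<notin> S \<Longrightarrow> v $ i = 0"
    and normal: "\<And>i. i \<in> S \<Longrightarrow> (C *v v) $ i = cross_moments $ i"
  shows "R2 M Z X S = 1 - mse v"
proof -
  let ?f = "\<lambda>a. expectation (\<lambda>\<omega>. (Z \<omega> - linear_predictor X S a \<omega>)\<^sup>2)"
  \<comment> \<open>The predictor ignores coefficients outside \<open>S\<close>, so they may be set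
    to 0.\<close>
  have f: "?f a = mse (\<chi> i. if i \<in> S then a i else 0)" for a
    by (simp add: mse_def linear_predictor_def if_distrib[of "\<lambda>x. x * _"] sum.If_cases cong: if_cong)
  have "?f (($) v) = mse v"
    unfolding f by (rule arg_cong[of _ _ mse]) (use v in \<open>auto simp: vec_eq_iff\<close>)
  moreover have le: "mse v \<le> ?f a" for a
    using mse_diff_normal_equations[of S "\<chi> i. if i \<in> S then a i else 0" v] v normal
      C_nonneg[of "(\<chi> i. if i \<in> S then a i else 0) - v"]
    by (simp add: f)
  ultimately have "is_arg_min ?f (\<lambda>_. True) (($) v)"
    by (simp add: is_arg_min_linorder)
  \<comment> \<open>The chosen minimizer need not be \<open>v\<close>, as its entries off
    \<open>S\<close> are arbitrary; only the minimum value is compared.\<close>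
  then have "is_arg_min ?f (\<lambda>_. True) (arg_min ?f (\<lambda>_. True))"
    unfolding arg_min_def by (rule someI[of "is_arg_min ?f (\<lambda>_. True)"])
  then have "?f (arg_min ?f (\<lambda>_. True)) \<le> ?f (($) v)"
    unfolding is_arg_min_linorder by blast
  then have "?f (arg_min ?f (\<lambda>_. True)) = mse v"
    unfolding \<open>?f (($) v) = mse v\<close> by (rule antisym) (rule le)
  then show ?thesis
    by (simp add: R2_def best_linear_predictor_def)
qed

section \<open>Loss of \<open>R2\<close> when predictors are removed\<close>

lemma R2_loss_characterization:
  assumes a: "\<And>i. i \<notin> B \<Longrightarrow> a $ i = 0"
    and normal: "\<And>i. i \<in> B \<Longrightarrow> (C *v a) $ i = cross_moments $ i"
    and "S \<subseteq> B"
  shows R2_loss_le: "(\<And>i. i \<notin> S \<Longrightarrow> w $ i = 0)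
      \<Longrightarrow> R2 M Z X B - R2 M Z X S \<le> (w - a) \<bullet> (C *v (w - a))"
    and R2_loss_attained: "\<exists>w. (\<forall>i. i \<notin> S \<longrightarrow> w $ i = 0)
      \<and> R2 M Z X B - R2 M Z X S = (w - a) \<bullet> (C *v (w - a))"
proof -
  obtain v where v: "\<And>i. i \<notin> S \<Longrightarrow> v $ i = 0"
      "\<And>i. i \<in> S \<Longrightarrow> (C *v v) $ i = cross_moments $ i"
    using positive_definite_restricted_system_solvable[OF cov_positive_definite] by metis
  have loss: "R2 M Z X B - R2 M Z X S = mse v - mse a"
    using R2_eq_mse[of B a] R2_eq_mse[of S v] a normal v by simp
  have diff: "mse w - mse a = (w - a) \<bullet> (C *v (w - a))" if "\<And>i. i \<notin> S \<Longrightarrow> w $ i = 0" for w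
    by (rule mse_diff_normal_equations[of B]) (use that a normal \<open>S \<subseteq> B\<close> in auto)
  show "\<exists>w. (\<forall>i. i \<notin> S \<longrightarrow> w $ i = 0)
      \<and> R2 M Z X B - R2 M Z X S = (w - a) \<bullet> (C *v (w - a))"
    using loss diff[of v] v(1) by auto
  \<comment> \<open>Among vectors supported on \<open>S\<close>, \<open>v\<close> has the least
    \<open>mse\<close>: the excess of \<open>w\<close> is a value of the nonnegative form of
    \<open>C\<close>.\<close>
  show "R2 M Z X B - R2 M Z X S \<le> (w - a) \<bullet> (C *v (w - a))" if w: "\<And>i. i \<notin> S \<Longrightarrow> w $ i = 0"
    using mse_diff_normal_equations[of S w v] v w C_nonneg[of "w - v"] diff[of w] loss by simp
qed

lemma sum_R2_loss_le:
  assumes unit: "\<And>i. C $ i $ i = 1" and "B \<noteq> {}" "A \<subseteq> B"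
  shows "(\<Sum>i\<in>B - A. R2 M Z X B - R2 M Z X (B - {i}))
    \<le> 1 / sparse_lambda_min C (card B) * (R2 M Z X B - R2 M Z X A)"
proof -
  let ?l = "sparse_lambda_min C (card B)"
  have card: "0 < card B"
    using \<open>B \<noteq> {}\<close> by (simp add: card_gt_0_iff)
  have l: "0 < ?l"
    by (rule sparse_lambda_min_pos[OF cov_positive_definite card])
  obtain a where a: "\<And>i. i \<notin> B \<Longrightarrow> a $ i = 0"
      "\<And>i. i \<in> B \<Longrightarrow> (C *v a) $ i = cross_moments $ i"
    using positive_definite_restricted_system_solvable[OF cov_positive_definite] by metis
  have single: "R2 M Z X B - R2 M Z X (B - {i}) \<le> (a $ i)\<^sup>2" for i
  proof -
    let ?e = "axis i (1::real)"
    have "R2 M Z X B - R2 M Z X (B - {i})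
        \<le> ((a - (a $ i) *\<^sub>R ?e) - a) \<bullet> (C *v ((a - (a $ i) *\<^sub>R ?e) - a))"
      by (rule R2_loss_le[OF a]) (use a in \<open>auto simp: axis_def\<close>)
    also have "\<dots> = (a $ i)\<^sup>2 * (?e \<bullet> (C *v ?e))"
      using quadratic_form_scaleR[of "- (a $ i)" ?e C] by simp
    \<comment> \<open>Unit variance enters here, through the diagonal of \<open>C\<close>.\<close>
    also have "?e \<bullet> (C *v ?e) = 1"
      by (simp add: inner_axis' matrix_vector_mul_component inner_axis unit)
    finally show ?thesis by simp
  qed
  obtain w where w: "\<forall>i. i \<notin> A \<longrightarrow> w $ i = 0"
      "R2 M Z X B - R2 M Z X A = (w - a) \<bullet> (C *v (w - a))"
    using R2_loss_attained[OF a \<open>A \<subseteq> B\<close>] by auto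
  have "(\<Sum>i\<in>B - A. R2 M Z X B - R2 M Z X (B - {i})) \<le> (\<Sum>i\<in>B - A. (a $ i)\<^sup>2)"
    by (rule sum_mono) (rule single)
  also have "\<dots> = (\<Sum>i\<in>B - A. ((w - a) $ i)\<^sup>2)"
    using w(1) by (intro sum.cong) auto
  also have "\<dots> \<le> (\<Sum>i\<in>UNIV. ((w - a) $ i)\<^sup>2)"
    by (rule sum_mono2) auto
  also have "\<dots> = (w - a) \<bullet> (w - a)"
    by (simp add: inner_vec_def power2_eq_square)
  also have "\<dots> \<le> 1 / ?l * (R2 M Z X B - R2 M Z X A)"
  proof -
    \<comment> \<open>Both vectors vanish off \<open>B\<close>, whence the sparsity level
      \<open>card B\<close>.\<close>
    have "card {i. (w - a) $ i \<noteq> 0} \<le> card B"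
      by (rule card_mono) (use w(1) a(1) \<open>A \<subseteq> B\<close> in force)+
    then show ?thesis
      using sparse_lambda_min_le_quadratic_form[OF card, of "w - a" C] l w(2)
      by (simp add: field_simps)
  qed
  finally show ?thesis .
qed

end

theorem theorem1:
  fixes M :: "'a measure"
    and Z :: "'a \<Rightarrow> real"
    and X :: "'n::finite \<Rightarrow> 'a \<Rightarrow> real"
    and B :: "'n set"
  assumes "prob_space M"
    and "Z \<in> borel_measurable M"
    and "\<And>i. X i \<in> borel_measurable M"
    and "prob_space.expectation M Z = 0"
    and "prob_space.variance M Z = 1"
    and "\<And>i. prob_space.expectation M (X i) = 0"
    and "\<And>i. prob_space.variance M (X i) = 1"
    and "positive_definite (cov_matrix M X)"
  shows "\<exists>\<beta>.
    (\<forall>A\<subseteq>B. (\<Sum>i\<in>B - A. R2 M Z X B - R2 M Z X (B - {i})) \<le> \<beta> * (R2 M Z X B - R2 M Z X A)) \<and>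
    (B \<noteq> {} \<longrightarrow>
      \<beta> \<le> 1 / sparse_lambda_min (cov_matrix M X) (card B) \<and>
      1 / sparse_lambda_min (cov_matrix M X) (card B) \<le> 1 / lambda_min (cov_matrix M X))"
proof (cases "B = {}")
  case False
  let ?C = "cov_matrix M X"
  \<comment> \<open>A non-integrable square would have integral 0 by convention, so unit variance forces
    square integrability.\<close>
  have "integrable M (\<lambda>\<omega>. (Z \<omega>)\<^sup>2)"
    by (rule ccontr) (use assms(4,5) in \<open>simp add: not_integrable_integral_eq\<close>)
  moreover have "integrable M (\<lambda>\<omega>. (X i \<omega>)\<^sup>2)" for i
    by (rule ccontr) (use assms(6,7)[of i] in \<open>simp add: not_integrable_integral_eq\<close>)
  ultimately interpret regression M Z X
    using assms by (intro regression.intro regression_axioms.intro) auto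
  have unit: "?C $ i $ i = 1" for i
    using assms(6,7)[of i] by (simp add: cov_matrix_def cov_def power2_eq_square)
  have card: "0 < card B"
    using False by (simp add: card_gt_0_iff)
  \<comment> \<open>Taking reciprocals reverses the order only between numbers of the same
    sign.\<close>
  have "0 < lambda_min ?C"
    unfolding lambda_min_eq_sparse_lambda_min[OF C_symmetric]
    by (rule sparse_lambda_min_pos[OF assms(8)]) simp
  then have "1 / sparse_lambda_min ?C (card B) \<le> 1 / lambda_min ?C"
    using lambda_min_le_sparse_lambda_min[OF C_symmetric card] by (simp add: frac_le)
  then show ?thesis
    using sum_R2_loss_le[OF unit False] by blast
\<comment> \<open>For empty \<open>B\<close> the only \<open>A\<close> is empty, and both sides are
  0 for any \<beta>.\<close>
qed auto

end
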